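(* If $G$ is a finite non-cyclic nilpotent group, then $G$ has an equal covering.
   Context: A covering of a group $G$ is a collection of proper subgroups of $G$ whose set-theoretic union is $G$. An equal covering of $G$ is a covering of $G$ all of whose members have the same order. *)

theory Defs
  imports "HOL-Algebra.Algebra"
begin

text \<open>The commutator convention is that of \<^const>\<open>derived\<close>, so that
  the commutator subgroup of \<open>H\<close> with itself is \<open>derived G H\<close>.\<close>

definition commutator_subgroup :: "('a, 'b) monoid_scheme \<Rightarrow> 'a set \<Rightarrow> 'a set \<Rightarrow> 'a set" where
  "commutator_subgroup G H K =
     generate G (\<Union>h\<in>H. \<Union>k\<in>K. {h \<otimes>\<^bsub>G\<^esub> k \<otimes>\<^bsub>G\<^esub> inv\<^bsub>G\<^esub> h \<otimes>\<^bsub>G\<^esub> inv\<^bsub>G\<^esub> k})"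

lemma commutator_subgroup_self: "commutator_subgroup G H H = derived G H"
  by (simp add: commutator_subgroup_def derived_def)

primrec lower_central_series :: "('a, 'b) monoid_scheme \<Rightarrow> nat \<Rightarrow> 'a set" where
  "lower_central_series G 0 = carrier G"
| "lower_central_series G (Suc n) =
     commutator_subgroup G (lower_central_series G n) (carrier G)"

definition nilpotent_group :: "('a, 'b) monoid_scheme \<Rightarrow> bool" where
  "nilpotent_group G \<longleftrightarrow> group G \<and> (\<exists>n. lower_central_series G n = {\<one>\<^bsub>G\<^esub>})"

definition covering :: "('a, 'b) monoid_scheme \<Rightarrow> 'a set set \<Rightarrow> bool" where
  "covering G \<C> \<longleftrightarrow>
     (\<forall>H\<in>\<C>. subgroup H G \<and> H \<noteq> carrier G) \<and> \<Union>\<C> = carrier G"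

text \<open>The order of a member is its cardinality as a natural number, which is the intended
  notion for finite groups; \<^const>\<open>card\<close> does not distinguish infinite cardinalities.\<close>

definition equal_covering :: "('a, 'b) monoid_scheme \<Rightarrow> 'a set set \<Rightarrow> bool" where
  "equal_covering G \<C> \<longleftrightarrow> covering G \<C> \<and> (\<forall>H\<in>\<C>. \<forall>K\<in>\<C>. card H = card K)"

end

theory Submission
  imports Defs
begin

text \<open>In a nilpotent group every maximal subgroup is normal of prime index. Suppose that for each
  prime \<open>p\<close> some element \<open>x\<^sub>p\<close> lay outside all normal subgroups of index \<open>p\<close>. The \<open>p\<close>-part of
  \<open>x\<^sub>p\<close> still avoids them, while lying in every normal subgroup of any other prime index. So the
  product of these \<open>p\<close>-parts lies in no maximal subgroup and generates \<open>G\<close>. Hence, if \<open>G\<close> is not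
  cyclic, there is a prime \<open>p\<close> such that the normal subgroups of index \<open>p\<close> cover \<open>G\<close>.\<close>

hide_const (open) Divisibility.prime

context group
begin

section \<open>Maximal subgroups of finite nilpotent groups\<close>

lemma subgroup_lower_central_series: "subgroup (lower_central_series G n) G"
proof (induction n)
  case (Suc n)
  then have "lower_central_series G n \<subseteq> carrier G"
    by (rule subgroup.subset)
  then show ?case
    unfolding lower_central_series.simps commutator_subgroup_def
    by (intro generate_is_subgroup) auto
qed (simp add: subgroup_self)

lemma commutator_in_lower_central_series:
  assumes "g \<in> lower_central_series G n" "h \<in> carrier G"
  shows "g \<otimes> h \<otimes> inv g \<otimes> inv h \<in> lower_central_series G (Suc n)"
  using assms unfolding lower_central_series.simps commutator_subgroup_def
  by (intro generate.incl) auto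

text \<open>Normalizers grow: take a term of the lower central series outside \<open>M\<close> whose
  successor lies in \<open>M\<close>. Commutators of its elements with elements of \<open>M\<close>
  fall into \<open>M\<close>, so the term normalizes \<open>M\<close>. The normalizer is thus
  strictly larger than \<open>M\<close>, and by maximality it is \<open>G\<close>.\<close>

lemma maximal_subgroup_normal:
  assumes nil: "nilpotent_group G" and M: "subgroup M G" "M \<noteq> carrier G"
    and max: "\<And>K. subgroup K G \<Longrightarrow> M \<subseteq> K \<Longrightarrow> K = M \<or> K = carrier G"
  shows "M \<lhd> G"
proof -
  interpret M: subgroup M G by (rule M(1))
  \<comment> \<open>The normalizer of \<open>M\<close>. Demanding conjugation by both
    \<open>g\<close> and \<open>inv g\<close> makes closure under inverses immediate.\<close>
  define N where
    "N = {g \<in> carrier G. \<forall>m\<in>M. g \<otimes> m \<otimes> inv g \<in> M \<and> inv g \<otimes> m \<otimes> g \<in> M}"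
  have N: "subgroup N G"
  proof (rule subgroupI)
    show "N \<subseteq> carrier G" "N \<noteq> {}"
      using M.mem_carrier one_closed by (auto simp: N_def intro!: exI[of _ \<one>])
  next
    fix g assume "g \<in> N"
    then show "inv g \<in> N" by (auto simp: N_def)
  next
    fix g h assume gh: "g \<in> N" "h \<in> N"
    then have car: "g \<in> carrier G" "h \<in> carrier G" by (auto simp: N_def)
    have "g \<otimes> h \<otimes> m \<otimes> inv (g \<otimes> h) \<in> M \<and> inv (g \<otimes> h) \<otimes> m \<otimes> (g \<otimes> h) \<in> M" if m: "m \<in> M" for m
    proof -
      have "g \<otimes> (h \<otimes> m \<otimes> inv h) \<otimes> inv g \<in> M" "inv h \<otimes> (inv g \<otimes> m \<otimes> g) \<otimes> h \<in> M"
        using gh m by (auto simp: N_def)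
      with car m show ?thesis by (simp add: inv_mult_group m_assoc)
    qed
    with car show "g \<otimes> h \<in> N" by (simp add: N_def)
  qed
  have M_le_N: "M \<subseteq> N" by (auto simp: N_def)
  have "\<exists>n. lower_central_series G n \<subseteq> M"
    using nil M.one_closed unfolding nilpotent_group_def by (metis empty_subsetI insert_subset)
  moreover have "\<not> lower_central_series G 0 \<subseteq> M"
    using M.subset M(2) by auto
  \<comment> \<open>\<open>Suc n\<close> is the first index whose term lies in \<open>M\<close>. It
    is not \<open>0\<close>, since \<open>M\<close> is proper.\<close>
  ultimately obtain n where n: "\<not> lower_central_series G n \<subseteq> M"
      "lower_central_series G (Suc n) \<subseteq> M"
    using ex_least_nat_less[of "\<lambda>n. lower_central_series G n \<subseteq> M"] by (metis order_refl)
  then obtain g where g: "g \<in> lower_central_series G n" "g \<notin> M" by auto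
  interpret L: subgroup "lower_central_series G n" G by (rule subgroup_lower_central_series)
  have conj: "x \<otimes> m \<otimes> inv x \<in> M" if x: "x \<in> lower_central_series G n" and m: "m \<in> M" for x m
  proof -
    have "x \<otimes> m \<otimes> inv x \<otimes> inv m \<in> M"
      using commutator_in_lower_central_series[OF x] n(2) m by auto
    with m have "x \<otimes> m \<otimes> inv x \<otimes> inv m \<otimes> m \<in> M" by simp
    with x m show ?thesis by (simp add: m_assoc)
  qed
  have "g \<in> N"
    using conj[of g] conj[of "inv g"] g by (auto simp: N_def)
  with g max[OF N M_le_N] have "N = carrier G" by auto
  then show ?thesis
    using M(1) by (auto simp: normal_inv_iff N_def)
qed

text \<open>By the correspondence theorem, \<open>G Mod M\<close> has only the trivial subgroups,
  while Cauchy's theorem gives it a subgroup of prime order. That subgroup must be the whole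
  quotient.\<close>

lemma maximal_normal_prime_index:
  assumes fin: "finite (carrier G)" and M: "M \<lhd> G" "M \<noteq> carrier G"
    and max: "\<And>K. subgroup K G \<Longrightarrow> M \<subseteq> K \<Longrightarrow> K = M \<or> K = carrier G"
  shows "prime (card (rcosets M))"
proof -
  interpret M: normal M G by (rule M(1))
  interpret Q: group "G Mod M" by (rule M.factorgroup_is_group)
  interpret h: group_hom G "G Mod M" "\<lambda>a. M #> a"
    by unfold_locales (rule M.r_coset_hom_Mod)
  have car: "carrier (G Mod M) = rcosets M" by (simp add: FactGroup_def)
  have finQ: "finite (carrier (G Mod M))"
    using fin by (simp add: carrier_FactGroup)
  have ord: "order (G Mod M) = card (rcosets M)" by (simp add: order_def car)
  have "card (rcosets M) \<noteq> 1"
  proof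
    assume "card (rcosets M) = 1"
    with lagrange[OF M.subgroup_axioms] have "card M = card (carrier G)"
      by (simp add: order_def)
    with M(2) card_subset_eq[OF fin M.subset] show False by simp
  qed
  then obtain p where p: "prime p" "p dvd order (G Mod M)"
    using ord prime_factor_nat by auto
  \<comment> \<open>With exponent \<open>1\<close>, Sylow's theorem yields a subgroup of order
    exactly \<open>p\<close>, which is Cauchy's theorem.\<close>
  then obtain m where "order (G Mod M) = p ^ 1 * m" by auto
  from sylow_thm[OF p(1) Q.is_group this finQ] obtain K where
    K: "subgroup K (G Mod M)" "card K = p" by auto
  interpret K: subgroup K "G Mod M" by (rule K(1))
  \<comment> \<open>The preimage of \<open>K\<close> under the quotient map; surjectivity of that
    map recovers \<open>K\<close> from \<open>L\<close>.\<close>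
  define L where "L = {x \<in> carrier G. M #> x \<in> K}"
  have L: "subgroup L G"
  proof (rule subgroupI)
    show "L \<subseteq> carrier G" by (auto simp: L_def)
    have "\<one> \<in> L" using h.hom_one K.one_closed by (simp add: L_def)
    then show "L \<noteq> {}" by auto
  next
    fix a assume "a \<in> L"
    then show "inv a \<in> L"
      using K.m_inv_closed[of "M #> a"] h.hom_inv[of a] by (auto simp: L_def)
  next
    fix a b assume "a \<in> L" "b \<in> L"
    then show "a \<otimes> b \<in> L"
      using K.m_closed[of "M #> a" "M #> b"] h.hom_mult[of a b] by (auto simp: L_def)
  qed
  have M_le_L: "M \<subseteq> L"
    using K.one_closed by (auto simp: L_def M.rcos_const)
  have K_img: "K = (\<lambda>a. M #> a) ` L"
    using K.subset by (auto simp: L_def carrier_FactGroup)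
  consider "L = M" | "L = carrier G" using max[OF L M_le_L] by auto
  then show ?thesis
  proof cases
    case 1
    have "K \<subseteq> {M}" unfolding K_img 1 by (auto simp: M.rcos_const)
    then have "card K \<le> 1" using card_mono[of "{M}" K] by simp
    with K(2) prime_gt_1_nat[OF p(1)] show ?thesis by simp
  next
    case 2
    then have "K = rcosets M" using K_img car by (simp add: carrier_FactGroup)
    with K(2) p(1) show ?thesis by simp
  qed
qed

lemma subgroup_in_maximal_subgroup:
  assumes fin: "finite (carrier G)" and H: "subgroup H G" "H \<noteq> carrier G"
  obtains M where "subgroup M G" "M \<noteq> carrier G" "H \<subseteq> M"
    "\<And>K. subgroup K G \<Longrightarrow> M \<subseteq> K \<Longrightarrow> K = M \<or> K = carrier G"
proof -
  define A where "A = {M. subgroup M G \<and> M \<noteq> carrier G}"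
  have "A \<subseteq> Pow (carrier G)" by (auto simp: A_def dest: subgroup.subset)
  then have "finite A" using fin finite_subset by blast
  then obtain M where "M \<in> A" "H \<subseteq> M" "\<forall>K\<in>A. M \<subseteq> K \<longrightarrow> M = K"
    using finite_has_maximal2[of A H] H by (auto simp: A_def)
  then show ?thesis using that[of M] by (auto simp: A_def)
qed

lemma nilpotent_subgroup_in_normal_prime_index:
  assumes "nilpotent_group G" "finite (carrier G)" "subgroup H G" "H \<noteq> carrier G"
  obtains M where "M \<lhd> G" "prime (card (rcosets M))" "H \<subseteq> M"
  using subgroup_in_maximal_subgroup[OF assms(2-4)]
    maximal_subgroup_normal[OF assms(1)] maximal_normal_prime_index[OF assms(2)]
  by metis

section \<open>Elements avoiding normal subgroups of prime index\<close>

lemma pow_in_normal_coprime_index: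
  fixes n :: nat
  assumes M: "M \<lhd> G" and fin: "finite (carrier G)" and x: "x \<in> carrier G"
    and n: "x [^] n \<in> M" "coprime n (card (rcosets M))"
  shows "x \<in> M"
proof -
  interpret M: normal M G by (rule M)
  interpret Q: group "G Mod M" by (rule M.factorgroup_is_group)
  have xQ: "M #> x \<in> carrier (G Mod M)" using x by (auto simp: carrier_FactGroup)
  have "(M #> x) [^]\<^bsub>G Mod M\<^esub> n = \<one>\<^bsub>G Mod M\<^esub>"
    using M.FactGroup_pow[OF x, of n] n(1) by (simp add: M.rcos_const)
  \<comment> \<open>The order of the coset of \<open>x\<close> divides both \<open>n\<close> and the
    index, so it is \<open>1\<close>.\<close>
  then have "Q.ord (M #> x) dvd n" using Q.pow_eq_id[OF xQ] by blast
  moreover have "Q.ord (M #> x) dvd card (rcosets M)"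
    using Q.ord_dvd_group_order[OF xQ] by (simp add: order_def FactGroup_def)
  ultimately have "Q.ord (M #> x) = 1"
    using n(2) coprime_common_divisor_nat by blast
  then have "M #> x = M" using Q.ord_eq_1[OF xQ] by simp
  then show ?thesis using x coset_join1 M.subgroup_axioms M.subset by metis
qed

text \<open>Take \<open>y = x [^] m\<close>, where \<open>m\<close> is the part of the group order
  prime to \<open>p\<close>. Then \<open>y\<close> has \<open>p\<close>-power order, which forces it
  into \<open>M\<close> when the index is another prime. For index \<open>p\<close>,
  \<open>y\<close> in \<open>M\<close> would force \<open>x\<close> into \<open>M\<close>, because
  \<open>m\<close> is coprime to \<open>p\<close>.\<close>

lemma prime_part_avoiding_normal_subgroups:
  assumes fin: "finite (carrier G)" and p: "prime p" and x: "x \<in> carrier G"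
    and avoid: "\<And>M. M \<lhd> G \<Longrightarrow> card (rcosets M) = p \<Longrightarrow> x \<notin> M"
  obtains y where "y \<in> carrier G"
    "\<And>M. M \<lhd> G \<Longrightarrow> prime (card (rcosets M)) \<Longrightarrow> y \<in> M \<longleftrightarrow> card (rcosets M) \<noteq> p"
proof -
  have "order G \<noteq> 0" using fin by (simp add: order_gt_0_iff_finite)
  then obtain m where m: "order G = p ^ multiplicity p (order G) * m" "\<not> p dvd m"
    using p by (metis multiplicity_decompose' not_prime_unit)
  define y where "y = x [^] m"
  have yc: "y \<in> carrier G" using x by (simp add: y_def)
  have "y [^] (p ^ multiplicity p (order G)) = \<one>"
    using pow_order_eq_1[OF x] x m(1) by (simp add: y_def nat_pow_pow mult.commute)
  moreover have "\<one> \<in> M" if "M \<lhd> G" for M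
    using that by (simp add: normal_imp_subgroup subgroup.one_closed)
  ultimately have "y \<in> M" if "M \<lhd> G" "prime (card (rcosets M))" "card (rcosets M) \<noteq> p" for M
    using that p primes_coprime[of p "card (rcosets M)"]
    by (intro pow_in_normal_coprime_index[OF that(1) fin yc, of "p ^ multiplicity p (order G)"])
      auto
  moreover have "y \<notin> M" if "M \<lhd> G" "card (rcosets M) = p" for M
  proof
    assume "y \<in> M"
    moreover have "coprime m p"
      using prime_imp_coprime[OF p m(2)] coprime_commute by blast
    ultimately have "x \<in> M"
      using that by (intro pow_in_normal_coprime_index[OF that(1) fin x, of m]) (auto simp: y_def)
    with avoid that show False by auto
  qed
  ultimately show ?thesis using that yc by blast
qed

text \<open>Multiplies the \<open>p\<close>-parts over \<open>p\<close> in \<open>S\<close>. The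
  equivalence, stronger than mere avoidance, is what the induction needs: a product of two elements
  outside \<open>M\<close> could fall into \<open>M\<close>.\<close>

lemma avoiding_normal_subgroups_of_prime_indices:
  assumes fin: "finite (carrier G)" and "finite S" "\<And>p. p \<in> S \<Longrightarrow> prime p"
    and "\<And>p. p \<in> S \<Longrightarrow> \<exists>x\<in>carrier G. \<forall>M. M \<lhd> G \<longrightarrow> card (rcosets M) = p \<longrightarrow> x \<notin> M"
  shows "\<exists>y\<in>carrier G. \<forall>M. M \<lhd> G \<longrightarrow> prime (card (rcosets M)) \<longrightarrow>
    (y \<in> M \<longleftrightarrow> card (rcosets M) \<notin> S)"
  using assms(2-)
proof (induction S)
  case empty
  show ?case
    by (intro bexI[of _ \<one>]) (auto simp: normal_imp_subgroup subgroup.one_closed)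
next
  case (insert p S)
  then obtain y where y: "y \<in> carrier G"
    "\<And>M. M \<lhd> G \<Longrightarrow> prime (card (rcosets M)) \<Longrightarrow> y \<in> M \<longleftrightarrow> card (rcosets M) \<notin> S"
    by (metis insertCI)
  obtain x where "x \<in> carrier G" "\<And>M. M \<lhd> G \<Longrightarrow> card (rcosets M) = p \<Longrightarrow> x \<notin> M"
    using insert.prems(2)[of p] by auto
  then obtain z where z: "z \<in> carrier G"
    "\<And>M. M \<lhd> G \<Longrightarrow> prime (card (rcosets M)) \<Longrightarrow> z \<in> M \<longleftrightarrow> card (rcosets M) \<noteq> p"
    using prime_part_avoiding_normal_subgroups[OF fin] insert.prems(1)[of p] by (metis insertI1)
  have "y \<otimes> z \<in> M \<longleftrightarrow> card (rcosets M) \<notin> insert p S"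
    if M: "M \<lhd> G" "prime (card (rcosets M))" for M
  proof -
    interpret M: subgroup M G using M(1) by (rule normal_imp_subgroup)
    \<comment> \<open>If the product lies in \<open>M\<close>, then each factor lies in
      \<open>M\<close> as soon as the other does. Since \<open>p\<close> is not in \<open>S\<close>,
      at most one factor is outside \<open>M\<close>.\<close>
    have "(y \<otimes> z) \<otimes> inv z = y" "inv y \<otimes> (y \<otimes> z) = z"
      using y(1) z(1) by (simp_all add: m_assoc flip: m_assoc[of "inv y"])
    then have "y \<in> M \<longleftrightarrow> z \<in> M" if "y \<otimes> z \<in> M"
      using M.m_closed[OF that, of "inv z"] M.m_closed[OF _ that, of "inv y"] by auto
    moreover have "y \<otimes> z \<in> M" if "y \<in> M" "z \<in> M"
      using that by simp
    ultimately show ?thesis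
      using y(2)[OF M] z(2)[OF M] \<open>p \<notin> S\<close> by auto
  qed
  with y(1) z(1) show ?case by (intro bexI[of _ "y \<otimes> z"]) auto
qed

section \<open>From avoidance to cyclicity, and the covering\<close>

lemma nilpotent_cyclic_if_no_covering_prime:
  assumes nil: "nilpotent_group G" and fin: "finite (carrier G)"
    and avoid: "\<And>p. prime p \<Longrightarrow>
      \<exists>x\<in>carrier G. \<forall>M. M \<lhd> G \<longrightarrow> card (rcosets M) = p \<longrightarrow> x \<notin> M"
  shows "cyclic_group G"
proof -
  \<comment> \<open>Every index divides \<open>order G\<close>, so the finitely many prime factors
    of \<open>order G\<close> suffice for \<open>y\<close> to avoid all normal subgroups of prime
    index.\<close>
  obtain y where y: "y \<in> carrier G" "\<And>M. M \<lhd> G \<Longrightarrow> prime (card (rcosets M)) \<Longrightarrow>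
      y \<in> M \<longleftrightarrow> card (rcosets M) \<notin> prime_factors (order G)"
    using avoiding_normal_subgroups_of_prime_indices[OF fin, of "prime_factors (order G)"] avoid
    by (metis finite_set_mset in_prime_factors_imp_prime)
  let ?H = "carrier (subgroup_generated G {y})"
  have "?H = carrier G"
  proof (rule ccontr)
    assume "?H \<noteq> carrier G"
    then obtain M where M: "M \<lhd> G" "prime (card (rcosets M))" "?H \<subseteq> M"
      using nilpotent_subgroup_in_normal_prime_index[OF nil fin subgroup_subgroup_generated]
      by metis
    have "y \<in> ?H" using y(1) by (simp add: carrier_subgroup_generated generate.incl)
    moreover have "card (rcosets M) \<in> prime_factors (order G)"
      using lagrange[OF normal_imp_subgroup[OF M(1)]] M(2) fin
      by (metis dvd_triv_left order_gt_0_iff_finite not_gr_zero prime_factorsI)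
    ultimately show False using y(2) M by auto
  qed
  with y(1) show ?thesis
    by (auto simp: cyclic_group carrier_subgroup_generated_by_singleton)
qed

lemma equal_covering_normal_index:
  assumes fin: "finite (carrier G)" and "k \<noteq> 1"
    and cover: "\<And>x. x \<in> carrier G \<Longrightarrow> \<exists>M. M \<lhd> G \<and> card (rcosets M) = k \<and> x \<in> M"
  shows "equal_covering G {M. M \<lhd> G \<and> card (rcosets M) = k}"
proof -
  have eq: "k * card M = order G" if "M \<lhd> G" "card (rcosets M) = k" for M
    using lagrange[OF normal_imp_subgroup[OF that(1)]] that(2) by simp
  have pos: "order G > 0" using fin by (simp add: order_gt_0_iff_finite)
  have "M \<noteq> carrier G" if "M \<lhd> G" "card (rcosets M) = k" for M
    using eq[OF that] pos \<open>k \<noteq> 1\<close> by (auto simp: order_def)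
  \<comment> \<open>Both sides times \<open>k\<close> equal \<open>order G\<close>; as this is
    positive, \<open>k\<close> is nonzero and cancels.\<close>
  moreover have "card H = card K" if "H \<lhd> G" "card (rcosets H) = k" "K \<lhd> G" "card (rcosets K) = k"
    for H K
    using eq[OF that(1,2)] eq[OF that(3,4)] pos by (metis mult_cancel1 mult_is_0 not_gr_zero)
  ultimately show ?thesis
    using cover by (auto simp: equal_covering_def covering_def
        dest: normal_imp_subgroup subgroup.mem_carrier)
qed

end

theorem theorem17:
  fixes G :: "('a, 'b) monoid_scheme"
  assumes "group G"
    and "finite (carrier G)"
    and "\<not> cyclic_group G"
    and "nilpotent_group G"
  shows "\<exists>\<C>. equal_covering G \<C>"
proof -
  interpret group G by (rule assms(1))
  \<comment> \<open>The contrapositive of the cyclicity criterion: some prime \<open>p\<close>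
    admits no element avoiding all normal subgroups of index \<open>p\<close>.\<close>
  obtain p where p: "prime p"
    "\<And>x. x \<in> carrier G \<Longrightarrow> \<exists>M. M \<lhd> G \<and> card (rcosets\<^bsub>G\<^esub> M) = p \<and> x \<in> M"
    using nilpotent_cyclic_if_no_covering_prime[OF assms(4,2)] assms(3) by metis
  moreover have "p \<noteq> 1" using p(1) by auto
  ultimately show ?thesis
    using equal_covering_normal_index[OF assms(2)] by blast
qed

end
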